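(* (i) For all $p$ and $q$ such that $0<p<q\le\infty$, $$\tfrac12\,d_{\mathrm{TV}}(p,q)=d_{\mathrm{Ko}}(p,q)=\max_{x\in(0,\infty)}\big(F_q(x)-F_p(x)\big).$$ (ii) Moreover, for each $p\in(0,\infty)$ the distance $d_{\mathrm{Ko}}(p,q)$ is strictly increasing in $q\in[p,\infty]$, and for each $q\in(0,\infty]$ the distance $d_{\mathrm{Ko}}(p,q)$ is strictly decreasing in $p\in(0,q]$. In particular, $$d_{\mathrm{Ko}}(p,q)<d_{\mathrm{Ko}}(p,\infty)=d_{\mathrm{Ko}}(p)$$ for all $p$ and $q$ such that $0<p\le q<\infty$, and $d_{\mathrm{Ko}}(p)$ is strictly decreasing in $p\in(0,\infty]$. Statement (ii) holds as well with $d_{\mathrm{TV}}$ in place of $d_{\mathrm{Ko}}$.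
   Context: For real $p>0$ (not necessarily an integer), the density and distribution functions of Student's distribution with $p$ degrees of freedom are $$f_p(x)=\frac{\Gamma\left(\frac{p+1}{2}\right)}{\sqrt{\pi p}\,\Gamma\left(\frac p2\right)}\left(1+\frac{x^2}{p}\right)^{-(p+1)/2},\qquad F_p(x)=\int_{-\infty}^x f_p(u)\,du,\qquad x\in\mathbb{R}.$$ For $p=\infty$, $f_\infty=\varphi$ and $F_\infty=\Phi$ are the density and distribution functions of the standard normal distribution. For $p,q\in(0,\infty]$, $$d_{\mathrm{Ko}}(p,q)=\sup_{x\in\mathbb{R}}|F_p(x)-F_q(x)|,\qquad d_{\mathrm{TV}}(p,q)=\frac12\int_{-\infty}^\infty|f_p(x)-f_q(x)|\,dx,$$ and $d_{\mathrm{Ko}}(p)=d_{\mathrm{Ko}}(p,\infty)$, $d_{\mathrm{TV}}(p)=d_{\mathrm{TV}}(p,\infty)$. *)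

theory Defs
  imports "HOL-Probability.Probability"
begin

text \<open>The number of degrees of freedom ranges over the extended positive half-line
  $(0, \infty]$ and is therefore an extended real; the value at other arguments
  (and hence everything below for \<open>p \<le> 0\<close>) is irrelevant.\<close>

definition student_density :: "ereal \<Rightarrow> real \<Rightarrow> real" where
  "student_density p x =
     (if p = \<infinity> then std_normal_density x
      else let r = real_of_ereal p in
        Gamma ((r + 1) / 2) / (sqrt (pi * r) * Gamma (r / 2))
          * (1 + x\<^sup>2 / r) powr (- (r + 1) / 2))"

definition student_cdf :: "ereal \<Rightarrow> real \<Rightarrow> real" where
  "student_cdf p x = (LBINT u:{..x}. student_density p u)"

definition d_Ko :: "ereal \<Rightarrow> ereal \<Rightarrow> real" where
  "d_Ko p q = (SUP x::real. \<bar>student_cdf p x - student_cdf q x\<bar>)"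

definition d_TV :: "ereal \<Rightarrow> ereal \<Rightarrow> real" where
  "d_TV p q = 1 / 2 * (LBINT x. \<bar>student_density p x - student_density q x\<bar>)"

definition d_Ko_normal :: "ereal \<Rightarrow> real" where
  "d_Ko_normal p = d_Ko p \<infinity>"

definition d_TV_normal :: "ereal \<Rightarrow> real" where
  "d_TV_normal p = d_TV p \<infinity>"

end

theory Submission
  imports Defs
begin

text \<open>Everything follows from one fact: for \<open>0 < p < q \<le> \<infinity>\<close> the even densities \<open>f\<^sub>p\<close> and \<open>f\<^sub>q\<close>
  cross exactly once on the positive half-line, \<open>f\<^sub>q\<close> being the larger one near the origin and
  \<open>f\<^sub>p\<close> the larger one in the tail (\<open>student_density_single_crossing\<close>).

  The crossing is seen on the log-ratio \<open>ln (f\<^sub>p / f\<^sub>q)\<close>, as a function \<open>N\<close> of \<open>y = x\<^sup>2\<close>. The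
  derivative of \<open>- ln f\<^sub>p\<close> in \<open>y\<close> is \<open>(p + 1) / (2 (p + y))\<close> (and \<open>1 / 2\<close> for \<open>p = \<infinity>\<close>), which gives
  \<open>N'(y)\<close> the sign of \<open>y - 1\<close>: the log-ratio decreases up to \<open>y = 1\<close> and increases afterwards. It
  is negative at \<open>0\<close>, because the peak height \<open>f\<^sub>p(0)\<close> strictly increases with \<open>p\<close>; this in turn
  comes from the strict concavity of the digamma function and, in the limit \<open>p = \<infinity>\<close>, from the
  log-convexity of the Gamma function. It cannot stay negative forever, since both densities
  have integral \<open>1\<close>. Hence it has exactly one zero.

  Integrating an even function with such a sign pattern and total integral \<open>0\<close> shows that
  \<open>F\<^sub>q - F\<^sub>p\<close> is odd, positive on the positive half-line, maximal at the crossing point \<open>x\<^sub>0\<close>, and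
  that \<open>\<integral> \<bar>f\<^sub>p - f\<^sub>q\<bar> = 4 (F\<^sub>q(x\<^sub>0) - F\<^sub>p(x\<^sub>0))\<close> (\<open>even_sign_change_primitive\<close>). This is the first
  part of the theorem. For the monotonicity, let \<open>p < q < r\<close> and let \<open>x\<^sub>0\<close> be the point at which
  \<open>F\<^sub>q - F\<^sub>p\<close> is maximal. As \<open>F\<^sub>r(x\<^sub>0) > F\<^sub>q(x\<^sub>0)\<close>, the distance from \<open>p\<close> to \<open>r\<close> strictly exceeds that
  from \<open>p\<close> to \<open>q\<close>; moving the left endpoint works in the same way.\<close>

section \<open>Normalisation of Student's density\<close>

text \<open>Student's distribution is a Gamma mixture of centred normal distributions. Writing the
  kernel \<open>(1 + x\<^sup>2 / r) powr (- s)\<close> as a Gamma integral in \<open>t\<close> and exchanging the integrals leaves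
  a Gaussian integral in \<open>x\<close> and then another Gamma integral in \<open>t\<close>. Working with
  nonnegative integrals yields integrability at the same time.\<close>

lemma nn_integral_powr_exp:
  fixes s a :: real
  assumes s: "s > 0" and a: "a > 0"
  shows "(\<integral>\<^sup>+t. ennreal (indicator {0..} t * t powr (s - 1) * exp (- (a * t))) \<partial>lborel)
           = ennreal (Gamma s * a powr (- s))"
proof -
  let ?I = "\<integral>\<^sup>+t. ennreal (indicator {0..} t * t powr (s - 1) * exp (- (a * t))) \<partial>lborel"
  have "ennreal (Gamma s) = (\<integral>\<^sup>+t. ennreal (indicator {0..} t * t powr (s - 1) / exp t) \<partial>lborel)"
    by (rule Gamma_conv_nn_integral_real[OF s])
  also have "\<dots> = ennreal a * (\<integral>\<^sup>+t. ennreal (indicator {0..} (a * t) * (a * t) powr (s - 1) / exp (a * t)) \<partial>lborel)"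
    using nn_integral_real_affine[of "\<lambda>t. ennreal (indicator {0..} t * t powr (s - 1) / exp t)" a 0] a
    by simp
  also have "(\<integral>\<^sup>+t. ennreal (indicator {0..} (a * t) * (a * t) powr (s - 1) / exp (a * t)) \<partial>lborel)
      = (\<integral>\<^sup>+t. ennreal (a powr (s - 1)) * ennreal (indicator {0..} t * t powr (s - 1) * exp (- (a * t))) \<partial>lborel)"
    using a by (intro nn_integral_cong)
      (auto simp: indicator_def powr_mult exp_minus field_simps zero_le_mult_iff simp flip: ennreal_mult')
  also have "\<dots> = ennreal (a powr (s - 1)) * ?I"
    by (subst nn_integral_cmult) auto
  finally have *: "ennreal (Gamma s) = ennreal a * (ennreal (a powr (s - 1)) * ?I)" .
  \<comment> \<open>\<open>?I\<close> might be infinite a priori, so the factor \<open>a powr s\<close> is cancelled by multiplying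
    with its inverse, which is a finite number.\<close>
  have "ennreal (a powr (- s)) * (ennreal a * (ennreal (a powr (s - 1)) * ?I)) = ?I"
    using a by (simp add: ennreal_mult'[symmetric] mult.assoc[symmetric] powr_diff powr_minus divide_simps)
  then have "?I = ennreal (a powr (- s)) * ennreal (Gamma s)"
    by (simp only: *[symmetric])
  then show ?thesis
    using s by (simp add: mult.commute ennreal_mult'[symmetric])
qed

lemma nn_integral_gaussian:
  fixes b :: real
  assumes b: "b > 0"
  shows "(\<integral>\<^sup>+x. ennreal (exp (- (b * x\<^sup>2))) \<partial>lborel) = ennreal (sqrt (pi / b))"
proof -
  define \<sigma> where "\<sigma> = sqrt (1 / (2 * b))"
  have \<sigma>: "\<sigma> > 0" "\<sigma>\<^sup>2 = 1 / (2 * b)" using b by (auto simp: \<sigma>_def)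
  have "emeasure (density lborel (normal_density 0 \<sigma>)) (space (density lborel (normal_density 0 \<sigma>))) = 1"
    by (rule prob_space.emeasure_space_1[OF prob_space_normal_density[OF \<sigma>(1)]])
  then have 1: "(\<integral>\<^sup>+x. ennreal (normal_density 0 \<sigma> x) \<partial>lborel) = 1"
    by (simp add: emeasure_density)
  have "(\<integral>\<^sup>+x. ennreal (exp (- (b * x\<^sup>2))) \<partial>lborel)
      = (\<integral>\<^sup>+x. ennreal (sqrt (pi / b)) * ennreal (normal_density 0 \<sigma> x) \<partial>lborel)"
    using b by (intro nn_integral_cong)
      (auto simp: normal_density_def \<sigma> ennreal_mult'[symmetric] real_sqrt_divide mult.commute)
  also have "\<dots> = ennreal (sqrt (pi / b))"
    by (subst nn_integral_cmult) (auto simp: 1)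
  finally show ?thesis .
qed

text \<open>The Tonelli argument with \<open>s = (r + 1) / 2\<close>: integrating out \<open>x\<close> contributes the factor
  \<open>sqrt (pi * r / t)\<close>, which lowers the Gamma parameter from \<open>s\<close> to \<open>s - 1 / 2 = r / 2\<close>.\<close>

lemma nn_integral_student_kernel:
  fixes r :: real
  assumes r: "r > 0"
  shows "(\<integral>\<^sup>+x. ennreal ((1 + x\<^sup>2 / r) powr (- (r + 1) / 2)) \<partial>lborel)
           = ennreal (sqrt (pi * r) * Gamma (r / 2) / Gamma ((r + 1) / 2))"
proof -
  define s where "s = (r + 1) / 2"
  have s: "s > 0" "s - 1 / 2 = r / 2" using r by (auto simp: s_def field_simps)
  have G: "Gamma s > 0" "Gamma (r / 2) > 0" using r s by auto
  have pos: "1 + x\<^sup>2 / r > 0" for x using r by (simp add: add_pos_nonneg)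
  let ?J = "\<integral>\<^sup>+x. ennreal ((1 + x\<^sup>2 / r) powr (- (r + 1) / 2)) \<partial>lborel"
  have e: "- (r + 1) / 2 = - s" by (simp add: s_def field_simps)
  have "ennreal (Gamma s) * ?J = (\<integral>\<^sup>+x. ennreal (Gamma s * (1 + x\<^sup>2 / r) powr (- s)) \<partial>lborel)"
    using G unfolding e by (subst nn_integral_cmult[symmetric]) (auto simp: ennreal_mult')
  also have "\<dots> = (\<integral>\<^sup>+x. (\<integral>\<^sup>+t. ennreal (indicator {0..} t * t powr (s - 1) * exp (- ((1 + x\<^sup>2 / r) * t))) \<partial>lborel) \<partial>lborel)"
    by (simp add: nn_integral_powr_exp s pos)
  also have "\<dots> = (\<integral>\<^sup>+t. (\<integral>\<^sup>+x. ennreal (indicator {0..} t * t powr (s - 1) * exp (- ((1 + x\<^sup>2 / r) * t))) \<partial>lborel) \<partial>lborel)"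
    by (rule lborel_pair.Fubini') simp
  also have "\<dots> = (\<integral>\<^sup>+t. ennreal (sqrt (pi * r)) * ennreal (indicator {0..} t * t powr (r / 2 - 1) * exp (- (1 * t))) \<partial>lborel)"
  proof (rule nn_integral_cong)
    fix t :: real
    show "(\<integral>\<^sup>+x. ennreal (indicator {0..} t * t powr (s - 1) * exp (- ((1 + x\<^sup>2 / r) * t))) \<partial>lborel)
        = ennreal (sqrt (pi * r)) * ennreal (indicator {0..} t * t powr (r / 2 - 1) * exp (- (1 * t)))"
    proof (cases "t > 0")
      case True
      have "(\<integral>\<^sup>+x. ennreal (indicator {0..} t * t powr (s - 1) * exp (- ((1 + x\<^sup>2 / r) * t))) \<partial>lborel)
          = (\<integral>\<^sup>+x. ennreal (t powr (s - 1) * exp (- t)) * ennreal (exp (- (t / r * x\<^sup>2))) \<partial>lborel)"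
        using True by (intro nn_integral_cong) (auto simp: ennreal_mult'[symmetric] algebra_simps exp_add[symmetric])
      also have "\<dots> = ennreal (t powr (s - 1) * exp (- t)) * ennreal (sqrt (pi / (t / r)))"
        using True r by (subst nn_integral_cmult) (simp_all only: nn_integral_gaussian divide_pos_pos, auto)
      also have "\<dots> = ennreal (t powr (s - 1) * exp (- t) * sqrt (pi / (t / r)))"
        by (rule ennreal_mult'[symmetric]) (use True r in auto)
      also have "t powr (s - 1) * exp (- t) * sqrt (pi / (t / r))
          = sqrt (pi * r) * (t powr (s - 1) * t powr (- 1 / 2) * exp (- t))"
        using True by (simp add: powr_minus powr_half_sqrt real_sqrt_divide real_sqrt_mult field_simps)
      also have "ennreal \<dots> = ennreal (sqrt (pi * r)) * ennreal (t powr (s - 1) * t powr (- 1 / 2) * exp (- t))"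
        by (rule ennreal_mult') (use r in auto)
      also have "t powr (s - 1) * t powr (- 1 / 2) = t powr (r / 2 - 1)"
        by (simp add: powr_add[symmetric] s_def add_divide_distrib)
      finally show ?thesis using True by simp
    \<comment> \<open>At \<open>t = 0\<close> both integrands vanish because of the convention \<open>0 powr a = 0\<close>.\<close>
    qed (cases "t = 0"; simp)
  qed
  also have "\<dots> = ennreal (sqrt (pi * r) * Gamma (r / 2))"
    using r nn_integral_powr_exp[of "r / 2" 1] by (subst nn_integral_cmult) (auto simp: ennreal_mult')
  finally have *: "ennreal (Gamma s) * ?J = ennreal (sqrt (pi * r) * Gamma (r / 2))" .
  have "?J = ennreal (1 / Gamma s) * (ennreal (Gamma s) * ?J)"
    using G by (simp add: ennreal_mult'[symmetric] mult.assoc[symmetric])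
  also have "\<dots> = ennreal (sqrt (pi * r) * Gamma (r / 2) / Gamma s)"
    unfolding * using G r by (simp add: ennreal_mult'[symmetric])
  finally show ?thesis by (simp add: s_def)
qed

lemma student_density_pos:
  assumes "0 < p"
  shows "student_density p x > 0"
proof (cases p)
  case (real r)
  then have "r > 0" using assms by simp
  moreover from this have "1 + x\<^sup>2 / r \<noteq> 0" using add_pos_nonneg[of 1 "x\<^sup>2 / r"] by simp
  ultimately show ?thesis using real by (auto simp: student_density_def Let_def)
qed (use assms in \<open>auto simp: student_density_def normal_density_pos\<close>)

lemma borel_measurable_student_density [measurable]:
  "student_density p \<in> borel_measurable borel"
  by (cases "p = \<infinity>") (simp_all add: student_density_def[abs_def] Let_def)

lemma has_bochner_integral_student_density:
  assumes "0 < p"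
  shows "has_bochner_integral lborel (student_density p) 1"
proof (cases "p = \<infinity>")
  case True
  then show ?thesis
    by (simp add: student_density_def[abs_def] has_bochner_integral_iff integrable_normal_density)
next
  case False
  with assms obtain r where p: "p = ereal r" "r > 0" by (cases p) auto
  have G: "Gamma ((r + 1) / 2) > 0" "Gamma (r / 2) > 0" using p by auto
  let ?C = "Gamma ((r + 1) / 2) / (sqrt (pi * r) * Gamma (r / 2))"
  have C: "?C > 0" using G p by auto
  have "(\<integral>\<^sup>+x. ennreal (student_density p x) \<partial>lborel)
      = (\<integral>\<^sup>+x. ennreal ?C * ennreal ((1 + x\<^sup>2 / r) powr (- (r + 1) / 2)) \<partial>lborel)"
    using C p by (intro nn_integral_cong) (simp add: student_density_def Let_def ennreal_mult'[symmetric])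
  also have "\<dots> = ennreal ?C * ennreal (sqrt (pi * r) * Gamma (r / 2) / Gamma ((r + 1) / 2))"
    by (subst nn_integral_cmult) (simp_all only: nn_integral_student_kernel[OF p(2)], simp)
  also have "\<dots> = ennreal 1"
    using C G p by (simp add: ennreal_mult'[symmetric] less_imp_neq[THEN not_sym])
  finally show ?thesis
    by (intro has_bochner_integral_nn_integral) (auto intro: less_imp_le student_density_pos assms)
qed

section \<open>The height of the peak\<close>

text \<open>The logarithmic derivative of the ratio is \<open>Digamma (s + 1/2) - Digamma s - 1 / (2 * s)\<close>.
  It is positive: the two increments of the strictly concave function \<open>Digamma\<close> over
  \<open>[s, s + 1/2]\<close> and \<open>[s + 1/2, s + 1]\<close> add up to \<open>1 / s\<close> by the functional equation, and the
  first of them is the larger one.\<close>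

lemma Gamma_half_step_ratio_strict_mono:
  fixes s t :: real
  assumes "0 < s" "s < t"
  shows "Gamma (s + 1/2) / (sqrt s * Gamma s) < Gamma (t + 1/2) / (sqrt t * Gamma t)"
proof -
  define g where "g s = ln_Gamma (s + 1/2) - ln_Gamma s - ln s / 2" for s :: real
  have "g s < g t"
  proof (rule DERIV_pos_imp_increasing[OF assms(2)])
    fix x assume "s \<le> x" "x \<le> t"
    with assms have x: "x > 0" by simp
    have "\<exists>z>x. z < x + 1/2 \<and> Digamma (x + 1/2) - Digamma x = (x + 1/2 - x) * Polygamma 1 z"
      using x by (intro MVT2) (auto intro!: derivative_eq_intros elim!: nonpos_Ints_cases)
    then obtain z where z: "x < z" "z < x + 1/2" "Digamma (x + 1/2) - Digamma x = Polygamma 1 z / 2"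
      by auto
    have "\<exists>w>x+1/2. w < x + 1 \<and> Digamma (x + 1) - Digamma (x + 1/2) = (x + 1 - (x + 1/2)) * Polygamma 1 w"
      using x by (intro MVT2) (auto intro!: derivative_eq_intros elim!: nonpos_Ints_cases)
    then obtain w where w: "x + 1/2 < w" "Digamma (x + 1) - Digamma (x + 1/2) = Polygamma 1 w / 2"
      by auto
    have "Polygamma 1 w < Polygamma 1 z"
      using x z w by (intro Polygamma_real_strict_antimono) auto
    moreover have "Digamma (x + 1) = Digamma x + 1 / x"
      using x by (intro Digamma_plus1) auto
    ultimately have "Digamma (x + 1/2) - Digamma x - 1 / (2 * x) > 0"
      using z w by simp
    moreover have "(g has_real_derivative (Digamma (x + 1/2) - Digamma x - 1 / (2 * x))) (at x)"
      unfolding g_def using x by (auto intro!: derivative_eq_intros)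
    ultimately show "\<exists>y. (g has_real_derivative y) (at x) \<and> 0 < y" by blast
  qed
  moreover have "exp (g x) = Gamma (x + 1/2) / (sqrt x * Gamma x)" if "x > 0" for x
    using that by (simp add: g_def exp_diff exp_add Gamma_real_pos_exp ln_sqrt[symmetric] field_simps)
  ultimately show ?thesis using assms by (metis exp_less_mono less_trans)
qed

text \<open>The bound \<open>\<le> 1\<close> is midpoint log-convexity, \<open>Gamma (t + 1/2)\<^sup>2 \<le> Gamma t * Gamma (t + 1)\<close>,
  combined with \<open>Gamma (t + 1) = t * Gamma t\<close>. Strictness comes for free from the strict
  monotonicity, by comparing with the ratio at \<open>s + 1\<close>.\<close>

lemma Gamma_half_step_ratio_less_1:
  fixes s :: real
  assumes s: "0 < s"
  shows "Gamma (s + 1/2) / (sqrt s * Gamma s) < 1"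
proof -
  have le: "Gamma (t + 1/2) / (sqrt t * Gamma t) \<le> 1" if t: "t > 0" for t :: real
  proof -
    have "(ln \<circ> Gamma) ((1 - 1/2) *\<^sub>R t + (1/2) *\<^sub>R (t + 1))
        \<le> (1 - 1/2) * (ln \<circ> Gamma) t + (1/2) * (ln \<circ> Gamma) (t + 1)"
      using t by (intro convex_onD[OF log_convex_Gamma_real]) auto
    also have "(1 - 1/2) *\<^sub>R t + (1/2) *\<^sub>R (t + 1) = t + 1/2" by (simp add: field_simps)
    also have "Gamma (t + 1) = t * Gamma t" using t by (intro Gamma_plus1) (auto elim!: nonpos_Ints_cases)
    then have "(1 - 1/2) * (ln \<circ> Gamma) t + (1/2) * (ln \<circ> Gamma) (t + 1) = ln (sqrt t * Gamma t)"
      using t Gamma_real_pos[OF t] by (simp add: ln_mult ln_sqrt field_simps)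
    finally have "Gamma (t + 1/2) \<le> sqrt t * Gamma t"
      using t by simp
    then show ?thesis using t by (simp add: divide_le_eq)
  qed
  have "Gamma (s + 1/2) / (sqrt s * Gamma s) < Gamma (s + 1 + 1/2) / (sqrt (s + 1) * Gamma (s + 1))"
    using s by (intro Gamma_half_step_ratio_strict_mono) auto
  also have "\<dots> \<le> 1" using s by (intro le) auto
  finally show ?thesis .
qed

lemma student_density_0:
  assumes "r > 0"
  shows "student_density (ereal r) 0 = Gamma (r/2 + 1/2) / (sqrt (r/2) * Gamma (r/2)) / sqrt (2 * pi)"
  using assms by (simp add: student_density_def Let_def real_sqrt_mult real_sqrt_divide add_divide_distrib)

lemma student_density_0_strict_mono:
  assumes "0 < p" "p < q"
  shows "student_density p 0 < student_density q 0"
proof -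
  obtain r where r: "p = ereal r" "r > 0" using assms by (cases p) auto
  show ?thesis
  proof (cases q)
    case (real u)
    with assms r show ?thesis
      by (simp add: student_density_0 divide_strict_right_mono Gamma_half_step_ratio_strict_mono del: divide_divide_eq_left)
  next
    case PInf
    have "student_density \<infinity> 0 = 1 / sqrt (2 * pi)"
      by (simp add: student_density_def std_normal_density_def)
    moreover have "student_density p 0 < 1 / sqrt (2 * pi)"
      unfolding r(1) student_density_0[OF r(2)]
      by (intro divide_strict_right_mono Gamma_half_step_ratio_less_1) (use r in auto)
    ultimately show ?thesis using PInf by simp
  qed (use assms in auto)
qed

section \<open>The single crossing of two densities\<close>

text \<open>The exponent of the density as a function of \<open>y = x\<^sup>2\<close>, normalised to vanish at the peak:
  \<open>student_density p x = student_density p 0 * exp (- neg_log_kernel p (x\<^sup>2))\<close>. In this form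
  the finite and the infinite case can be treated together.\<close>

definition neg_log_kernel :: "ereal \<Rightarrow> real \<Rightarrow> real" where
  "neg_log_kernel p y =
     (if p = \<infinity> then y / 2
      else (real_of_ereal p + 1) / 2 * ln (1 + y / real_of_ereal p))"

definition neg_log_kernel_deriv :: "ereal \<Rightarrow> real \<Rightarrow> real" where
  "neg_log_kernel_deriv p y =
     (if p = \<infinity> then 1 / 2
      else (real_of_ereal p + 1) / (2 * (real_of_ereal p + y)))"

lemma student_density_eq_exp:
  assumes "0 < p"
  shows "student_density p x = student_density p 0 * exp (- neg_log_kernel p (x\<^sup>2))"
proof (cases p)
  case (real r)
  then have "r > 0" using assms by simp
  moreover from this have "1 + x\<^sup>2 / r > 0" by (simp add: add_pos_nonneg)
  ultimately show ?thesis using real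
    by (simp add: student_density_def Let_def neg_log_kernel_def powr_def field_simps)
qed (use assms in \<open>auto simp: student_density_def std_normal_density_def neg_log_kernel_def\<close>)

lemma has_real_derivative_neg_log_kernel:
  assumes "0 < p" "0 \<le> y"
  shows "(neg_log_kernel p has_real_derivative neg_log_kernel_deriv p y) (at y)"
proof (cases p)
  case (real r)
  then have r: "r > 0" using assms by simp
  with assms have pos: "1 + y / r > 0" "r + y > 0" by (simp_all add: add_pos_nonneg)
  have "((\<lambda>y. (r + 1) / 2 * ln (1 + y / r)) has_real_derivative
      (r + 1) / 2 * (inverse r / (1 + y / r))) (at y)"
    using r pos by (auto intro!: derivative_eq_intros simp: field_simps)
  also have "(r + 1) / 2 * (inverse r / (1 + y / r)) = (r + 1) / (2 * (r + y))"
    using r pos by (simp add: divide_simps)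
  finally show ?thesis using real by (simp add: neg_log_kernel_def[abs_def] neg_log_kernel_deriv_def)
qed (use assms in \<open>auto simp: neg_log_kernel_def[abs_def] neg_log_kernel_deriv_def intro!: derivative_eq_intros\<close>)

text \<open>All the log-ratios turn at the same place: the pole terms combine to
  \<open>(q + 1) (p + y) - (p + 1) (q + y) = (q - p) (y - 1)\<close>, whatever \<open>p\<close> and \<open>q\<close> are.\<close>

lemma neg_log_kernel_deriv_diff:
  assumes "0 < p" "p < q" "0 \<le> y"
  obtains k where "k > 0" "neg_log_kernel_deriv q y - neg_log_kernel_deriv p y = k * (y - 1)"
proof -
  obtain r where r: "p = ereal r" "r > 0" using assms by (cases p) auto
  have ry: "r + y > 0" using r assms by simp
  show ?thesis
  proof (cases q)
    case (real u)
    with r assms have u: "r < u" "u + y > 0" by auto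
    show ?thesis
    proof
      show "(u - r) / (2 * (r + y) * (u + y)) > 0" using u ry by simp
      show "neg_log_kernel_deriv q y - neg_log_kernel_deriv p y = (u - r) / (2 * (r + y) * (u + y)) * (y - 1)"
        using u ry r real by (simp add: neg_log_kernel_deriv_def divide_simps) (simp add: algebra_simps)
    qed
  next
    case PInf
    show ?thesis
    proof
      show "1 / (2 * (r + y)) > 0" using ry by simp
      show "neg_log_kernel_deriv q y - neg_log_kernel_deriv p y = 1 / (2 * (r + y)) * (y - 1)"
        using ry r PInf by (simp add: neg_log_kernel_deriv_def divide_simps) (simp add: algebra_simps)
    qed
  qed (use assms in auto)
qed

text \<open>The log-ratio \<open>N\<close> is negative on \<open>[0, 1]\<close>, where it decreases from a negative value, and
  increases on \<open>[1, \<infinity>)\<close>. Normalisation forces it to reach zero: if \<open>N\<close> were negative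
  everywhere, \<open>f\<^sub>p < f\<^sub>q\<close> would hold pointwise, although both densities have integral \<open>1\<close>.\<close>

lemma student_density_single_crossing:
  assumes p: "0 < p" and pq: "p < q"
  obtains x0 where "x0 > 0"
    "\<And>x. \<bar>x\<bar> < x0 \<Longrightarrow> student_density p x < student_density q x"
    "\<And>x. \<bar>x\<bar> > x0 \<Longrightarrow> student_density q x < student_density p x"
proof -
  have q: "0 < q" using p pq by (rule less_trans)
  define N where "N y = neg_log_kernel q y - neg_log_kernel p y
      + ln (student_density p 0) - ln (student_density q 0)" for y
  note c_pos = student_density_pos[OF p, of 0] student_density_pos[OF q, of 0]
  \<comment> \<open>Hence \<open>N (x\<^sup>2)\<close> is the logarithm of the ratio of the two densities at \<open>x\<close>.\<close>
  have N_ratio: "student_density p x = student_density q x * exp (N (x\<^sup>2))" for x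
    using c_pos
    by (subst (1 2) student_density_eq_exp) (simp_all add: p q N_def exp_add exp_diff exp_minus field_simps)
  have lt_iff: "student_density p x < student_density q x \<longleftrightarrow> N (x\<^sup>2) < 0"
    and gt_iff: "student_density q x < student_density p x \<longleftrightarrow> N (x\<^sup>2) > 0" for x
    using student_density_pos[OF q, of x] unfolding N_ratio[of x]
    by (simp_all add: mult_less_cancel_left1 mult_less_cancel_left2)
  have deriv: "(N has_real_derivative neg_log_kernel_deriv q y - neg_log_kernel_deriv p y) (at y)"
    if "0 \<le> y" for y
    unfolding N_def using that p q
    by (auto intro!: derivative_eq_intros has_real_derivative_neg_log_kernel)
  have cont: "continuous_on A N" if "A \<subseteq> {0..}" for A
    using deriv that by (meson DERIV_isCont atLeast_iff continuous_at_imp_continuous_on subset_iff)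
  have dec: "N b < N a" if "0 \<le> a" "a < b" "b \<le> 1" for a b
  proof (rule DERIV_neg_imp_decreasing_open[OF that(2)])
    fix y assume y: "a < y" "y < b"
    then obtain k where "k > 0" "neg_log_kernel_deriv q y - neg_log_kernel_deriv p y = k * (y - 1)"
      using neg_log_kernel_deriv_diff[OF p pq, of y] \<open>0 \<le> a\<close> by auto
    then show "\<exists>D. (N has_real_derivative D) (at y) \<and> D < 0"
      using deriv[of y] y that by (auto intro!: exI[of _ "k * (y - 1)"] simp: mult_less_0_iff)
  qed (use that in \<open>auto intro: cont\<close>)
  have inc: "N a < N b" if "1 \<le> a" "a < b" for a b
  proof (rule DERIV_pos_imp_increasing_open[OF that(2)])
    fix y assume y: "a < y" "y < b"
    then obtain k where "k > 0" "neg_log_kernel_deriv q y - neg_log_kernel_deriv p y = k * (y - 1)"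
      using neg_log_kernel_deriv_diff[OF p pq, of y] \<open>1 \<le> a\<close> by auto
    then show "\<exists>D. (N has_real_derivative D) (at y) \<and> D > 0"
      using deriv[of y] y that by (auto intro!: exI[of _ "k * (y - 1)"])
  qed (use that in \<open>auto intro: cont\<close>)
  have N0: "N 0 < 0"
    using lt_iff[of 0] student_density_0_strict_mono[OF p pq] by simp
  have N_unit: "N y < 0" if "0 \<le> y" "y \<le> 1" for y
    using dec[of 0 y] N0 that by (cases "y = 0") auto
  have "\<exists>x. N (x\<^sup>2) \<ge> 0"
  proof (rule ccontr)
    assume "\<nexists>x. N (x\<^sup>2) \<ge> 0"
    then have less: "student_density p x < student_density q x" for x
      using lt_iff[of x] by (meson not_less)
    have "has_bochner_integral lborel (\<lambda>x. student_density q x - student_density p x) (1 - 1)"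
      by (intro has_bochner_integral_diff has_bochner_integral_student_density p q)
    then have "AE x in lborel. student_density q x - student_density p x = 0"
      using integral_nonneg_eq_0_iff_AE[of lborel "\<lambda>x. student_density q x - student_density p x"] less
      by (auto simp: has_bochner_integral_iff intro: less_imp_le)
    then have "AE x in (lborel :: real measure). False"
      by (rule eventually_mono) (metis less less_irrefl right_minus_eq)
    then show False
      using AE_iff_measurable[of UNIV "lborel :: real measure" "\<lambda>_. False"] by simp
  qed
  then obtain x where "N (x\<^sup>2) \<ge> 0" by blast
  then obtain y1 where y1: "0 \<le> y1" "N y1 \<ge> 0" using zero_le_power2[of x] by blast
  with N_unit[of y1] have "y1 > 1" by linarith
  obtain y0 where y0: "1 \<le> y0" "y0 \<le> y1" "N y0 = 0"
    using IVT'[of N 1 0 y1] N_unit[of 1] y1 \<open>y1 > 1\<close> cont[of "{1..y1}"] by auto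
  \<comment> \<open>Beyond \<open>1\<close> strict monotonicity makes \<open>y0\<close> the only zero.\<close>
  have N_neg: "N y < 0" if "0 \<le> y" "y < y0" for y
    using N_unit[of y] inc[of y y0] y0 that by (cases "y \<le> 1") auto
  have N_pos: "N y > 0" if "y0 < y" for y
    using inc[of y0 y] y0 that by auto
  show thesis
  proof
    show "sqrt y0 > 0" using y0 by simp
    fix x :: real
    show "student_density p x < student_density q x" if "\<bar>x\<bar> < sqrt y0"
      unfolding lt_iff
    proof (rule N_neg)
      show "x\<^sup>2 < y0" using that by (metis real_sqrt_abs real_sqrt_less_iff)
    qed simp
    show "student_density q x < student_density p x" if "\<bar>x\<bar> > sqrt y0"
      unfolding gt_iff
    proof (rule N_pos)
      show "y0 < x\<^sup>2" using that by (metis real_sqrt_abs real_sqrt_less_iff)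
    qed
  qed
qed

section \<open>Primitives of even functions with one sign change\<close>

lemma set_integral_pos_interval:
  fixes d :: "real \<Rightarrow> real"
  assumes int: "set_integrable lborel {a<..b} d" and "a < b" and pos: "\<And>x. a < x \<Longrightarrow> x < b \<Longrightarrow> d x > 0"
  shows "(LBINT x:{a<..b}. d x) > 0"
proof -
  let ?D = "\<lambda>x. indicator {a<..b} x *\<^sub>R d x"
  have nn: "AE x in lborel. ?D x \<ge> 0"
    using AE_lborel_singleton[of b] by eventually_elim (use pos in \<open>force simp: indicator_def\<close>)
  have "\<not> (AE x in lborel. ?D x = 0)"
  proof
    assume "AE x in lborel. ?D x = 0"
    then have AE: "AE x in lborel. x \<notin> {a<..<b}"
      by (rule eventually_mono) (use pos in \<open>force simp: indicator_def split: if_splits\<close>)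
    have "{x \<in> space lborel. \<not> x \<notin> {a<..<b}} = {a<..<b}" "{a<..<b} \<in> sets lborel" by auto
    from AE_iff_measurable[OF this(2,1)] AE have "emeasure lborel {a<..<b} = 0" by blast
    with \<open>a < b\<close> show False by simp
  qed
  with nn have "integral\<^sup>L lborel ?D \<noteq> 0"
    using integral_nonneg_eq_0_iff_AE[of lborel ?D] int by (auto simp: set_integrable_def)
  moreover have "integral\<^sup>L lborel ?D \<ge> 0" by (intro integral_nonneg_AE nn)
  ultimately show ?thesis by (simp add: set_lebesgue_integral_def)
qed

text \<open>Evenness and the vanishing total integral make the primitive \<open>H\<close> odd. It increases on
  \<open>[- x0, x0]\<close> and decreases on \<open>[x0, \<infinity>)\<close>; on the latter it also is nonnegative, being minus the
  integral of \<open>d\<close> over a tail on which \<open>d < 0\<close>. Positivity and the location of the maximum of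
  \<open>\<bar>H\<bar>\<close> can be read off from this. Finally, \<open>\<bar>d\<bar>\<close> agrees with \<open>2 d\<close> restricted to
  \<open>(- x0, x0]\<close> minus \<open>d\<close>, except at \<open>\<plusminus> x0\<close>, and so has integral \<open>2 (H x0 - H (- x0)) = 4 H x0\<close>.\<close>

lemma even_sign_change_primitive:
  fixes d :: "real \<Rightarrow> real"
  defines "H \<equiv> \<lambda>x. LBINT u:{..x}. d u"
  assumes int: "integrable lborel d" and even: "\<And>x. d (- x) = d x" and zero: "(LBINT x. d x) = 0"
    and x0: "x0 > 0"
    and pos: "\<And>x. \<bar>x\<bar> < x0 \<Longrightarrow> d x > 0" and neg: "\<And>x. \<bar>x\<bar> > x0 \<Longrightarrow> d x < 0"
  shows "x > 0 \<Longrightarrow> H x > 0" and "\<bar>H x\<bar> \<le> H x0" and "(LBINT x. \<bar>d x\<bar>) = 4 * H x0"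
proof -
  have sint: "set_integrable lborel A d" if "A \<in> sets borel" for A
    using int that unfolding set_integrable_def by (intro integrable_mult_indicator) auto
  have split: "H b - H a = (LBINT u:{a<..b}. d u)" if "a < b" for a b
  proof -
    have "H b = (LBINT u:{..a} \<union> {a<..b}. d u)"
      using that by (simp add: H_def ivl_disj_un)
    also have "\<dots> = H a + (LBINT u:{a<..b}. d u)"
      unfolding H_def by (intro set_integral_Un sint) auto
    finally show ?thesis by simp
  qed
  have tail: "H a = - (LBINT u:{a<..}. d u)" for a
  proof -
    have "{..a} \<union> {a<..} = UNIV" by auto
    then have "0 = (LBINT u:{..a} \<union> {a<..}. d u)"
      using zero by (simp add: set_lebesgue_integral_def)
    also have "\<dots> = H a + (LBINT u:{a<..}. d u)"
      unfolding H_def by (intro set_integral_Un sint) auto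
    finally show ?thesis by simp
  qed
  have odd: "H (- a) = - H a" for a
  proof -
    have "H (- a) = (LBINT u:{u. - u \<in> {..- a}}. d (- u))"
      unfolding H_def by (rule set_integral_reflect)
    also have "\<dots> = (LBINT u:{a<..}. d u)"
      unfolding set_lebesgue_integral_def
    proof (rule integral_cong_AE)
      show "AE u in lborel. indicat_real {u. - u \<in> {..- a}} u *\<^sub>R d (- u) = indicat_real {a<..} u *\<^sub>R d u"
        using AE_lborel_singleton[of a] by eventually_elim (auto simp: even indicator_def)
    qed (use int in auto)
    finally show ?thesis using tail[of a] by simp
  qed
  have inc: "H a < H b" if "- x0 \<le> a" "a < b" "b \<le> x0" for a b
  proof -
    have "(LBINT u:{a<..b}. d u) > 0"
      by (rule set_integral_pos_interval) (use that in \<open>auto intro!: sint pos\<close>)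
    with split[OF that(2)] show ?thesis by simp
  qed
  have dec: "H b < H a" if "x0 \<le> a" "a < b" for a b
  proof -
    have "(LBINT u:{a<..b}. - d u) > 0"
    proof (rule set_integral_pos_interval)
      show "set_integrable lborel {a<..b} (\<lambda>u. - d u)"
        using sint[of "{a<..b}"] by (simp add: set_integrable_def)
      show "- d u > 0" if "a < u" for u
        using neg[of u] that x0 \<open>x0 \<le> a\<close> by simp
    qed (use that in auto)
    with split[OF that(2)] show ?thesis by (simp add: set_integral_uminus sint)
  qed
  have nonneg: "H a \<ge> 0" if "x0 \<le> a" for a
  proof -
    have tail_neg: "d u = - \<bar>d u\<bar>" if "a < u" for u
      using neg[of u] that \<open>x0 \<le> a\<close> x0 by simp
    have "(LBINT u:{a<..}. d u) = (\<integral>u. - (indicator {a<..} u * \<bar>d u\<bar>) \<partial>lborel)"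
      unfolding set_lebesgue_integral_def
      by (rule Bochner_Integration.integral_cong) (use tail_neg in \<open>auto simp: indicator_def\<close>)
    also have "\<dots> \<le> 0" by simp
    finally show ?thesis using tail[of a] by simp
  qed
  have zero': "H 0 = 0" using odd[of 0] by simp
  have Hpos: "H a > 0" if "a > 0" for a
  proof (cases "a \<le> x0")
    case True
    with inc[of 0 a] that x0 zero' show ?thesis by simp
  next
    case False
    with dec[of a "a + 1"] nonneg[of "a + 1"] show ?thesis by simp
  qed
  have max: "H a \<le> H x0" if "a > 0" for a
    using inc[of a x0] dec[of x0 a] that x0 by (cases a x0 rule: linorder_cases) auto
  show "H x > 0" if "x > 0" using Hpos that .
  show "\<bar>H x\<bar> \<le> H x0"
    using odd[of x] max[of x] max[of "- x"] Hpos[of x] Hpos[of "- x"] zero' Hpos[OF x0]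
    by (cases x "0 :: real" rule: linorder_cases) auto
  have "(LBINT u. \<bar>d u\<bar>) = (LBINT u. 2 * (indicator {- x0<..x0} u *\<^sub>R d u) - d u)"
  proof (rule integral_cong_AE)
    show "AE u in lborel. \<bar>d u\<bar> = 2 * (indicator {- x0<..x0} u *\<^sub>R d u) - d u"
      using AE_lborel_singleton[of x0] AE_lborel_singleton[of "- x0"]
    proof eventually_elim
      case (elim u)
      then show ?case
        using pos[of u] neg[of u] x0 by (cases "\<bar>u\<bar>" x0 rule: linorder_cases) (auto simp: indicator_def)
    qed
  qed (use int in auto)
  also have "\<dots> = 2 * (LBINT u:{- x0<..x0}. d u) - (LBINT u. d u)"
    using int sint[of "{- x0<..x0}"] by (simp add: set_integrable_def set_lebesgue_integral_def)
  also have "\<dots> = 4 * H x0"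
    using split[of "- x0" x0] x0 zero odd[of x0] by simp
  finally show "(LBINT x. \<bar>d x\<bar>) = 4 * H x0" .
qed

section \<open>Comparison of distribution functions and distances\<close>

lemma student_density_minus [simp]: "student_density p (- x) = student_density p x"
  by (cases "p = \<infinity>") (simp_all add: student_density_def Let_def normal_density_def)

lemma student_comparison:
  assumes p: "0 < p" and pq: "p < q"
  obtains x0 where "x0 > 0"
    "\<And>x. x > 0 \<Longrightarrow> student_cdf p x < student_cdf q x"
    "\<And>x. \<bar>student_cdf p x - student_cdf q x\<bar> \<le> student_cdf q x0 - student_cdf p x0"
    "d_TV p q = 2 * (student_cdf q x0 - student_cdf p x0)"
proof -
  have q: "0 < q" using p pq by (rule less_trans)
  obtain x0 where x0: "x0 > 0"
    "\<And>x. \<bar>x\<bar> < x0 \<Longrightarrow> student_density p x < student_density q x"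
    "\<And>x. \<bar>x\<bar> > x0 \<Longrightarrow> student_density q x < student_density p x"
    by (rule student_density_single_crossing[OF p pq]) (rule that)
  let ?d = "\<lambda>x. student_density q x - student_density p x"
  have d: "has_bochner_integral lborel ?d (1 - 1)"
    by (intro has_bochner_integral_diff has_bochner_integral_student_density p q)
  then have int: "integrable lborel ?d" and zero: "(LBINT x. ?d x) = 0"
    by (auto simp: has_bochner_integral_iff)
  have sint: "set_integrable lborel {..x} (student_density r)" if "0 < r" for x r
    unfolding set_integrable_def
    using has_bochner_integral_student_density[OF that]
    by (intro integrable_mult_indicator) (auto simp: has_bochner_integral_iff)
  have H: "(LBINT u:{..x}. ?d u) = student_cdf q x - student_cdf p x" for x
    unfolding student_cdf_def by (intro set_integral_diff sint p q)
  note concl = even_sign_change_primitive[OF int _ zero x0(1), unfolded H]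
  show thesis
  proof
    show "x0 > 0" by fact
    show "student_cdf p x < student_cdf q x" if "x > 0" for x
      using concl(1)[OF _ _ _ that] x0(2,3) by simp
    show "\<bar>student_cdf p x - student_cdf q x\<bar> \<le> student_cdf q x0 - student_cdf p x0" for x
      using concl(2)[of x] x0(2,3) by (simp add: abs_minus_commute)
    show "d_TV p q = 2 * (student_cdf q x0 - student_cdf p x0)"
      using concl(3) x0(2,3) by (simp add: d_TV_def abs_minus_commute)
  qed
qed

lemma student_cdf_strict_mono:
  assumes "0 < p" "p < q" "x > 0"
  shows "student_cdf p x < student_cdf q x"
  by (rule student_comparison[OF assms(1,2)]) (use assms(3) in simp)

lemma d_Ko_attained:
  assumes "0 < p" "p < q"
  obtains x0 where "x0 > 0" "d_Ko p q = student_cdf q x0 - student_cdf p x0"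
    "\<And>x. student_cdf q x - student_cdf p x \<le> d_Ko p q" "d_TV p q = 2 * d_Ko p q"
proof -
  obtain x0 where x0: "x0 > 0" "\<And>x. x > 0 \<Longrightarrow> student_cdf p x < student_cdf q x"
    "\<And>x. \<bar>student_cdf p x - student_cdf q x\<bar> \<le> student_cdf q x0 - student_cdf p x0"
    "d_TV p q = 2 * (student_cdf q x0 - student_cdf p x0)"
    by (rule student_comparison[OF assms]) (rule that)
  have "d_Ko p q = student_cdf q x0 - student_cdf p x0"
    unfolding d_Ko_def
  proof (rule cSup_eq_maximum)
    show "student_cdf q x0 - student_cdf p x0 \<in> range (\<lambda>x. \<bar>student_cdf p x - student_cdf q x\<bar>)"
      using x0(3)[of x0] by (intro image_eqI[of _ _ x0]) auto
  qed (use x0(3) in auto)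
  moreover have "student_cdf q x - student_cdf p x \<le> student_cdf q x0 - student_cdf p x0" for x
    using x0(3)[of x] by linarith
  ultimately show thesis using that[of x0] x0(1,4) by simp
qed

lemma cdf_diff_le_d_Ko:
  assumes "0 < p" "p < q"
  shows "student_cdf q x - student_cdf p x \<le> d_Ko p q"
  by (rule d_Ko_attained[OF assms])

lemma d_Ko_self [simp]: "d_Ko p p = 0" and d_TV_self [simp]: "d_TV p p = 0"
  by (simp_all add: d_Ko_def d_TV_def)

lemma d_TV_eq_d_Ko:
  assumes "0 < p" "p \<le> q"
  shows "d_TV p q = 2 * d_Ko p q"
proof (cases "p = q")
  case False
  with assms have "p < q" by simp
  show ?thesis by (rule d_Ko_attained[OF assms(1) \<open>p < q\<close>])
qed simp

lemma d_Ko_pos: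
  assumes "0 < p" "p < q"
  shows "d_Ko p q > 0"
proof -
  have "0 < student_cdf q 1 - student_cdf p 1"
    using student_cdf_strict_mono[OF assms, of 1] by simp
  also have "\<dots> \<le> d_Ko p q" by (rule cdf_diff_le_d_Ko[OF assms])
  finally show ?thesis .
qed

text \<open>Strictness needs the supremum to be attained at a point \<open>x0 > 0\<close>: there the pointwise
  inequality between the distribution functions is strict.\<close>

lemma d_Ko_less_right:
  assumes "0 < p" "p \<le> q" "q < r"
  shows "d_Ko p q < d_Ko p r"
proof (cases "p = q")
  case False
  with assms have pq: "p < q" and pr: "p < r" and q: "0 < q" by auto
  obtain x0 where x0: "x0 > 0" "d_Ko p q = student_cdf q x0 - student_cdf p x0"
    by (rule d_Ko_attained[OF assms(1) pq]) (rule that)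
  have "d_Ko p q < student_cdf r x0 - student_cdf p x0"
    using student_cdf_strict_mono[OF q assms(3) x0(1)] x0(2) by simp
  also have "\<dots> \<le> d_Ko p r" by (rule cdf_diff_le_d_Ko[OF assms(1) pr])
  finally show ?thesis .
qed (use assms d_Ko_pos[OF assms(1)] in simp)

lemma d_Ko_less_left:
  assumes "0 < p" "p < q" "q \<le> r"
  shows "d_Ko q r < d_Ko p r"
proof (cases "q = r")
  case False
  with assms have qr: "q < r" and pr: "p < r" and q: "0 < q" by auto
  obtain x0 where x0: "x0 > 0" "d_Ko q r = student_cdf r x0 - student_cdf q x0"
    by (rule d_Ko_attained[OF q qr]) (rule that)
  have "d_Ko q r < student_cdf r x0 - student_cdf p x0"
    using student_cdf_strict_mono[OF assms(1,2) x0(1)] x0(2) by simp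
  also have "\<dots> \<le> d_Ko p r" by (rule cdf_diff_le_d_Ko[OF assms(1) pr])
  finally show ?thesis .
qed (use assms d_Ko_pos[OF assms(1,2)] in simp)

theorem proposition1p1:
  shows
    "(\<forall>p q :: ereal. 0 < p \<and> p < q \<and> q \<le> \<infinity> \<longrightarrow>
        1 / 2 * d_TV p q = d_Ko p q \<and>
        (\<exists>x0 \<in> {0::real<..}.
           d_Ko p q = student_cdf q x0 - student_cdf p x0 \<and>
           (\<forall>x \<in> {0::real<..}.
              student_cdf q x - student_cdf p x \<le> student_cdf q x0 - student_cdf p x0)))
     \<and>
     ((\<forall>p :: ereal. 0 < p \<and> p < \<infinity> \<longrightarrow> strict_mono_on {p..\<infinity>} (\<lambda>q. d_Ko p q)) \<and>
      (\<forall>q :: ereal. 0 < q \<and> q \<le> \<infinity> \<longrightarrow> strict_antimono_on {0<..q} (\<lambda>p. d_Ko p q)) \<and>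
      (\<forall>p q :: ereal. 0 < p \<and> p \<le> q \<and> q < \<infinity> \<longrightarrow>
         d_Ko p q < d_Ko p \<infinity> \<and> d_Ko p \<infinity> = d_Ko_normal p) \<and>
      strict_antimono_on {0<..\<infinity>} d_Ko_normal)
     \<and>
     ((\<forall>p :: ereal. 0 < p \<and> p < \<infinity> \<longrightarrow> strict_mono_on {p..\<infinity>} (\<lambda>q. d_TV p q)) \<and>
      (\<forall>q :: ereal. 0 < q \<and> q \<le> \<infinity> \<longrightarrow> strict_antimono_on {0<..q} (\<lambda>p. d_TV p q)) \<and>
      (\<forall>p q :: ereal. 0 < p \<and> p \<le> q \<and> q < \<infinity> \<longrightarrow>
         d_TV p q < d_TV p \<infinity> \<and> d_TV p \<infinity> = d_TV_normal p) \<and>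
      strict_antimono_on {0<..\<infinity>} d_TV_normal)"
proof (intro conjI allI impI)
  fix p q :: ereal
  assume pq: "0 < p \<and> p < q \<and> q \<le> \<infinity>"
  then have p: "0 < p" and q: "p < q" by auto
  obtain x0 where x0: "x0 > 0" "d_Ko p q = student_cdf q x0 - student_cdf p x0"
    "\<And>x. student_cdf q x - student_cdf p x \<le> d_Ko p q" "d_TV p q = 2 * d_Ko p q"
    by (rule d_Ko_attained[OF p q]) (rule that)
  show "1 / 2 * d_TV p q = d_Ko p q" using x0 by simp
  show "\<exists>x0 \<in> {0::real<..}.
           d_Ko p q = student_cdf q x0 - student_cdf p x0 \<and>
           (\<forall>x \<in> {0::real<..}.
              student_cdf q x - student_cdf p x \<le> student_cdf q x0 - student_cdf p x0)"
    using x0 by (intro bexI[of _ x0]) auto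
next
  fix p :: ereal
  assume p: "0 < p \<and> p < \<infinity>"
  show "strict_mono_on {p..\<infinity>} (\<lambda>q. d_Ko p q)"
    using p by (intro strict_mono_onI d_Ko_less_right) auto
  show "strict_mono_on {p..\<infinity>} (\<lambda>q. d_TV p q)"
    using p by (intro strict_mono_onI) (auto simp: d_TV_eq_d_Ko intro: d_Ko_less_right)
next
  fix q :: ereal
  assume "0 < q \<and> q \<le> \<infinity>"
  show "strict_antimono_on {0<..q} (\<lambda>p. d_Ko p q)"
    by (intro monotone_onI d_Ko_less_left) auto
  show "strict_antimono_on {0<..q} (\<lambda>p. d_TV p q)"
    by (intro monotone_onI) (auto simp: d_TV_eq_d_Ko intro: d_Ko_less_left)
next
  fix p q :: ereal
  assume pq: "0 < p \<and> p \<le> q \<and> q < \<infinity>"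
  show "d_Ko p q < d_Ko p \<infinity>" using pq by (intro d_Ko_less_right) auto
  then show "d_TV p q < d_TV p \<infinity>" using pq by (simp add: d_TV_eq_d_Ko)
  show "d_Ko p \<infinity> = d_Ko_normal p" by (simp add: d_Ko_normal_def)
  show "d_TV p \<infinity> = d_TV_normal p" by (simp add: d_TV_normal_def)
next
  show "strict_antimono_on {0<..\<infinity>} d_Ko_normal"
    by (intro monotone_onI) (auto simp: d_Ko_normal_def intro: d_Ko_less_left)
  show "strict_antimono_on {0<..\<infinity>} d_TV_normal"
    by (intro monotone_onI) (auto simp: d_TV_normal_def d_TV_eq_d_Ko intro: d_Ko_less_left)
qed

end
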